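(* Let $r \geq 1$ and $n \geq r$ be integers, and let $G$ be the disjoint union of $n$ complete graphs, each of order at least two (the orders need not be equal). Then $G$ is $r$-EKR.
   Context: Graphs are finite and simple. An independent set in a graph $G=(V,E)$ is a subset of $V$ not containing any edge of $G$. For an integer $r\geq 1$, $\mathcal{I}^{(r)}(G)=\{A\subseteq V(G) : |A|=r \text{ and } A \text{ is an independent set}\}$. For $v\in V(G)$, the star at $v$ is $\mathcal{I}_v^{(r)}(G)=\{A\in \mathcal{I}^{(r)}(G): v\in A\}$. A family of sets is intersecting if any two of its members have non-empty intersection. A graph $G$ is $r$-EKR if no intersecting family $\mathcal{A}\subseteq\mathcal{I}^{(r)}(G)$ is larger than the largest star, i.e. every intersecting $\mathcal{A}\subseteq\mathcal{I}^{(r)}(G)$ satisfies $|\mathcal{A}|\leq \max_{v\in V(G)}|\mathcal{I}_v^{(r)}(G)|$. *)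

theory Defs
  imports "Graph_Theory.Kuratowski" "HOL-Library.Disjoint_Sets"
begin

text \<open>
  A finite simple graph is rendered as in the library, by \<^locale>\<open>pair_graph\<close>: a finite
  loop-free symmetric relation on a finite vertex set, in which an undirected edge is
  the pair of arcs in both directions.
\<close>

definition independent_set :: "'a pair_pre_digraph \<Rightarrow> 'a set \<Rightarrow> bool" where
  "independent_set G A \<longleftrightarrow> A \<subseteq> pverts G \<and> (\<forall>u\<in>A. \<forall>v\<in>A. (u, v) \<notin> parcs G)"

definition indep_family :: "nat \<Rightarrow> 'a pair_pre_digraph \<Rightarrow> 'a set set" where
  "indep_family r G = {A. A \<subseteq> pverts G \<and> card A = r \<and> independent_set G A}"

definition indep_star :: "nat \<Rightarrow> 'a pair_pre_digraph \<Rightarrow> 'a \<Rightarrow> 'a set set" where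
  "indep_star r G v = {A \<in> indep_family r G. v \<in> A}"

definition intersecting :: "'a set set \<Rightarrow> bool" where
  "intersecting \<A> \<longleftrightarrow> (\<forall>A\<in>\<A>. \<forall>B\<in>\<A>. A \<inter> B \<noteq> {})"

text \<open>
  Meaningful for finite \<^term>\<open>G\<close> with at least one vertex, since \<^const>\<open>Max\<close> is
  unspecified on the empty set.
\<close>

definition EKR :: "nat \<Rightarrow> 'a pair_pre_digraph \<Rightarrow> bool" where
  "EKR r G \<longleftrightarrow> (\<forall>\<A> \<subseteq> indep_family r G. intersecting \<A> \<longrightarrow>
     card \<A> \<le> Max ((\<lambda>v. card (indep_star r G v)) ` pverts G))"

text \<open>
  The graph \<^term>\<open>G\<close> is the internal disjoint union of the graphs \<^term>\<open>H i\<close>, whose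
  vertex sets have to be pairwise disjoint already.
\<close>

definition is_disjoint_union ::
    "'a pair_pre_digraph \<Rightarrow> 'i set \<Rightarrow> ('i \<Rightarrow> 'a pair_pre_digraph) \<Rightarrow> bool" where
  "is_disjoint_union G I H \<longleftrightarrow>
     disjoint_family_on (\<lambda>i. pverts (H i)) I \<and>
     pverts G = (\<Union>i\<in>I. pverts (H i)) \<and>
     parcs G = (\<Union>i\<in>I. parcs (H i))"

lemma pair_graph_disjoint_union:
  assumes "is_disjoint_union G I H" "finite I" "\<And>i. i \<in> I \<Longrightarrow> pair_graph (H i)"
  shows "pair_graph G"
proof -
  have V: "pverts G = (\<Union>i\<in>I. pverts (H i))" and E: "parcs G = (\<Union>i\<in>I. parcs (H i))"
    using assms(1) by (auto simp: is_disjoint_union_def)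
  have H: "fst e \<in> pverts (H i)" "snd e \<in> pverts (H i)" "fst e \<noteq> snd e"
    "prod.swap e \<in> parcs (H i)" if "i \<in> I" "e \<in> parcs (H i)" for i e
  proof -
    interpret pair_graph "H i" using assms(3) that(1) .
    have "sym (parcs (H i))"
      using pair_sym_arcs by (simp add: symmetric_def)
    then show "prod.swap e \<in> parcs (H i)"
      using that(2) by (cases e) (auto dest: symD)
    show "fst e \<in> pverts (H i)" "snd e \<in> pverts (H i)" "fst e \<noteq> snd e"
      using that(2) by (simp_all add: arc_fst_in_verts arc_snd_in_verts pair_no_loops)
  qed
  have fin: "finite (pverts (H i))" "finite (parcs (H i))" if "i \<in> I" for i
  proof -
    interpret pair_graph "H i" using assms(3) that .
    show "finite (pverts (H i))" "finite (parcs (H i))"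
      by (rule pair_finite_verts pair_finite_arcs)+
  qed
  have "sym (parcs G)"
  proof (rule symI)
    fix u v assume "(u, v) \<in> parcs G"
    then obtain i where "i \<in> I" "(u, v) \<in> parcs (H i)" by (auto simp: E)
    with H(4)[of i "(u, v)"] show "(v, u) \<in> parcs G" by (auto simp: E)
  qed
  then have "symmetric (with_proj G)"
    by (simp add: symmetric_def)
  moreover have "finite (pverts G)" "finite (parcs G)"
    using assms(2) fin by (auto simp: V E)
  moreover have "fst e \<in> pverts G" "snd e \<in> pverts G" "fst e \<noteq> snd e"
    if "e \<in> parcs G" for e
    using that H(1-3) unfolding V E by blast+
  ultimately show ?thesis
    by unfold_locales
qed

end

theory Submission
  imports Defs "HOL-Combinatorics.Permutations" "HOL-Number_Theory.Cong"
begin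

text \<open>
  If all cliques have the same order, Katona's cycle method applies: the vertices are placed on a
  cycle so that the cliques recur periodically, whence every cyclic interval of length \<open>r \<le> n\<close> is
  independent and an intersecting family contains at most \<open>r\<close> of the intervals. Averaging over the
  automorphism group, which is transitive on independent \<open>r\<close>-sets, compares the family with a star,
  for which \<open>r\<close> intervals are always attained; no cardinality has to be computed.
  Otherwise take a vertex \<open>w\<close> in a clique that is not of minimal order, and another vertex \<open>v\<close> of
  this clique. Replacing \<open>w\<close> by \<open>v\<close> yields an intersecting family avoiding \<open>w\<close>; the sets lost by
  identification yield, after removing \<open>w\<close>, an intersecting family of \<open>(r-1)\<close>-sets avoiding the
  whole clique of \<open>w\<close>. Induction bounds both by the stars at a fixed vertex of a smallest clique.
\<close>

section \<open>Cyclic intervals\<close>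

definition cyc_interval :: "nat \<Rightarrow> nat \<Rightarrow> nat \<Rightarrow> nat set" where
  "cyc_interval m r t = (\<lambda>s. (t + s) mod m) ` {..<r}"

lemma mod_less_double: "(a::nat) < 2 * m \<Longrightarrow> a mod m = (if a < m then a else a - m)"
  by (simp add: mod_if)

text \<open>A common point means that the two starting points are fewer than \<open>r\<close> steps
  apart along the cycle; with \<open>s \<le> t\<close> the disjuncts are the direct way from
  \<open>s\<close> to \<open>t\<close> and the way across the wrap-around. All sums stay below
  \<open>2 * m\<close>, so \<open>mod\<close> subtracts \<open>m\<close> at most once.\<close>

lemma cyc_interval_meet:
  assumes "s < m" "t < m" "r \<le> m" "cyc_interval m r s \<inter> cyc_interval m r t \<noteq> {}" "s \<le> t"
  shows "t < s + r \<or> s + m < t + r"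
proof -
  obtain a b where ab: "a < r" "b < r" "(s + a) mod m = (t + b) mod m"
    using assms(4) by (auto simp: cyc_interval_def)
  have "s + a < 2 * m" "t + b < 2 * m" using assms ab by auto
  with ab(3) have "(if s + a < m then s + a else s + a - m) = (if t + b < m then t + b else t + b - m)"
    by (simp only: mod_less_double)
  then show ?thesis using ab assms by (auto split: if_splits)
qed

text \<open>Measured from a fixed \<open>t0\<close> in \<open>T\<close>, every start has offset
  below \<open>r\<close> or above \<open>m - r\<close>. The offsets \<open>j\<close> and
  \<open>j + m - r\<close> with \<open>0 < j < r\<close> belong to disjoint intervals, the gaps
  between them being \<open>m - r\<close> and \<open>r\<close>, both at least \<open>r\<close>
  because \<open>2 * r \<le> m\<close>. So \<open>T\<close> uses at most one offset of each of these
  \<open>r - 1\<close> pairs, besides offset 0.\<close>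

lemma card_intersecting_cyc_intervals:
  assumes "2 * r \<le> m" "T \<subseteq> {..<m}"
    and meet: "\<And>s t. s \<in> T \<Longrightarrow> t \<in> T \<Longrightarrow> cyc_interval m r s \<inter> cyc_interval m r t \<noteq> {}"
  shows "card T \<le> r"
proof (cases "T = {}")
  case False
  then obtain t0 where t0: "t0 \<in> T" by auto
  \<comment> \<open>\<open>d t\<close> is the number of forward steps from \<open>t0\<close> to
    \<open>t\<close>; \<open>g\<close> sends both offsets of a pair to the smaller one, so it is
    injective on \<open>T\<close>.\<close>
  define d where "d t = (if t0 \<le> t then t - t0 else t + m - t0)" for t
  define g where "g t = (if d t < r then d t else d t + r - m)" for t
  have near: "t < s + r \<or> s + m < t + r" if "s \<in> T" "t \<in> T" "s \<le> t" for s t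
    using that assms by (intro cyc_interval_meet) auto
  have lt: "t < m" if "t \<in> T" for t using that assms by auto
  have d: "d t < r \<or> m < d t + r" "d t < m" if "t \<in> T" for t
    using near[of t t0] near[of t0 t] lt[of t] lt[of t0] that t0 unfolding d_def
    by (cases "t0 \<le> t"; linarith | auto)+
  have "inj_on g T"
  proof (rule linorder_inj_onI)
    fix s t assume st: "s < t" "s \<in> T" "t \<in> T"
    have "d s \<noteq> d t"
      using st lt[of s] lt[of t] lt[of t0] t0 by (auto simp: d_def)
    moreover have "d t \<noteq> d s + m - r" "d s \<noteq> d t + m - r"
      using near[OF st(2,3)] st lt[of s] lt[of t] lt[of t0] t0 assms(1)
      by (auto simp: d_def split: if_splits)
    ultimately show "g s \<noteq> g t"
      using d[of s] d[of t] st assms(1) by (auto simp: g_def)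
  qed auto
  moreover have "g ` T \<subseteq> {..<r}"
    using d by (fastforce simp: g_def)
  ultimately show ?thesis
    using card_inj_on_le[of g T "{..<r}"] by simp
qed simp

text \<open>The starts are found by going back from \<open>p\<close> by 0 up to \<open>r - 1\<close>
  steps on the cycle.\<close>

lemma card_cyc_intervals_through:
  assumes "r \<le> m" "p < m"
  shows "r \<le> card {t. t < m \<and> p \<in> cyc_interval m r t}"
proof -
  let ?f = "\<lambda>s. if s \<le> p then p - s else p + m - s"
  have "inj_on ?f {..<r}"
    using assms by (auto simp: inj_on_def split: if_splits)
  moreover have "?f ` {..<r} \<subseteq> {t. t < m \<and> p \<in> cyc_interval m r t}"
    using assms by (auto simp: cyc_interval_def image_iff intro!: bexI)
  ultimately show ?thesis
    using card_inj_on_le[of ?f "{..<r}" "{t. t < m \<and> p \<in> cyc_interval m r t}"] by simp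
qed

text \<open>As \<open>n\<close> divides \<open>m\<close>, wrapping around the cycle preserves
  residues modulo \<open>n\<close>, and at most \<open>n\<close> consecutive numbers have distinct
  residues. With the residue of a position naming its class, every interval becomes a partial
  transversal.\<close>

lemma inj_on_mod_cyc_interval:
  assumes "r \<le> n" "n dvd m"
  shows "inj_on (\<lambda>p. p mod n) (cyc_interval m r t)" "card (cyc_interval m r t) = r"
proof -
  have mm: "((t + s) mod m) mod n = (t + s) mod n" for s
    using assms(2) by (rule mod_mod_cancel)
  have eq: "a = b" if "a < r" "b < r" "(t + a) mod n = (t + b) mod n" for a b
  proof -
    have "[a = b] (mod n)" using that(3) by (simp flip: cong_def add: cong_add_lcancel_nat)
    then show ?thesis using that(1,2) assms(1) by (auto simp: cong_def)
  qed
  show "inj_on (\<lambda>p. p mod n) (cyc_interval m r t)"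
    by (auto simp: cyc_interval_def inj_on_def mm dest: eq)
  have "inj_on (\<lambda>s. (t + s) mod m) {..<r}"
    using eq mm by (metis (mono_tags, lifting) inj_onI lessThan_iff)
  then show "card (cyc_interval m r t) = r"
    by (simp add: cyc_interval_def card_image)
qed

section \<open>Partial transversals\<close>

text \<open>For \<open>c\<close> naming the clique of each vertex these are the independent
  \<open>r\<close>-sets. Working with \<open>V\<close> and \<open>c\<close> instead of a graph lets
  the later induction delete vertices while \<open>c\<close> stays fixed.\<close>

definition transversals :: "nat \<Rightarrow> 'a set \<Rightarrow> ('a \<Rightarrow> 'b) \<Rightarrow> 'a set set" where
  "transversals r V c = {A. A \<subseteq> V \<and> card A = r \<and> inj_on c A}"

definition cls :: "'a set \<Rightarrow> ('a \<Rightarrow> 'b) \<Rightarrow> 'b \<Rightarrow> 'a set" where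
  "cls V c i = {v \<in> V. c v = i}"

text \<open>Automorphisms of the union of cliques: whole classes may be exchanged.
  \<open>permutes\<close> also fixes every point outside \<open>V\<close>, so there are only
  finitely many for finite \<open>V\<close>.\<close>

definition auts :: "'a set \<Rightarrow> ('a \<Rightarrow> 'b) \<Rightarrow> ('a \<Rightarrow> 'a) set" where
  "auts V c = {g. g permutes V \<and> (\<forall>u\<in>V. \<forall>v\<in>V. c (g u) = c (g v) \<longleftrightarrow> c u = c v)}"

lemma finite_transversals: "finite V \<Longrightarrow> finite (transversals r V c)"
  by (rule finite_subset[of _ "Pow V"]) (auto simp: transversals_def)

lemma finite_auts: "finite V \<Longrightarrow> finite (auts V c)"
  by (rule finite_subset[OF _ finite_permutations[of V]]) (auto simp: auts_def)

lemma id_in_auts: "id \<in> auts V c"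
  by (auto simp: auts_def permutes_id)

lemma comp_in_auts:
  assumes "g \<in> auts V c" "h \<in> auts V c"
  shows "g \<circ> h \<in> auts V c"
proof -
  have "h v \<in> V" if "v \<in> V" for v
    using assms(2) that by (auto simp: auts_def permutes_in_image)
  then show ?thesis
    using assms by (auto simp: auts_def intro: permutes_compose)
qed

lemma auts_image_transversals:
  assumes "g \<in> auts V c" "A \<in> transversals r V c"
  shows "g ` A \<in> transversals r V c"
proof -
  have g: "g permutes V" and A: "A \<subseteq> V" "card A = r" "inj_on c A"
    using assms by (auto simp: auts_def transversals_def)
  have "inj_on g A" using permutes_inj[OF g] by (rule inj_on_subset) simp
  then have "card (g ` A) = r" using A by (simp add: card_image)
  moreover have "g ` A \<subseteq> V" using A permutes_image[OF g] by blast
  moreover have "inj_on c (g ` A)"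
  proof (rule inj_onI, elim imageE)
    fix x y a b assume *: "c x = c y" "x = g a" "a \<in> A" "y = g b" "b \<in> A"
    then have "a \<in> V" "b \<in> V" "c (g a) = c (g b)" using A(1) by auto
    then have "c a = c b" using assms(1) unfolding auts_def by blast
    then show "x = y" using * A(3) by (auto dest: inj_onD)
  qed
  ultimately show ?thesis by (simp add: transversals_def)
qed

text \<open>Serves transitivity on two levels: for permuting the classes, and for matching the
  vertices of a class with those of its image.\<close>

lemma bij_betw_image_subset_exists:
  assumes "finite X" "finite Y" "A \<subseteq> X" "B \<subseteq> Y" "card A = card B" "card X = card Y"
  shows "\<exists>f. bij_betw f X Y \<and> f ` A = B"
proof -
  have fin: "finite A" "finite B" using assms finite_subset by blast+
  obtain f where f: "bij_betw f A B"
    using finite_same_card_bij[OF fin assms(5)] by blast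
  have "card (X - A) = card (Y - B)"
    using assms fin by (simp add: card_Diff_subset)
  then obtain g where g: "bij_betw g (X - A) (Y - B)"
    using finite_same_card_bij[of "X - A" "Y - B"] assms(1,2) by blast
  have "bij_betw (\<lambda>x. if x \<in> A then f x else g x) (A \<union> (X - A)) (B \<union> (Y - B))"
    using f g by (intro bij_betw_disjoint_Un) auto
  moreover have "(\<lambda>x. if x \<in> A then f x else g x) ` A = B"
    using f by (auto simp: bij_betw_def)
  moreover have "A \<union> (X - A) = X" "B \<union> (Y - B) = Y" using assms by auto
  ultimately show ?thesis by metis
qed

lemma card_transversal_cls:
  assumes "A \<in> transversals r V c"
  shows "card (A \<inter> cls V c i) = (if i \<in> c ` A then 1 else 0)"
proof (cases "i \<in> c ` A")
  case True
  then obtain a where a: "a \<in> A" "c a = i" by auto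
  then have "A \<inter> cls V c i = {a}"
    using assms by (auto simp: transversals_def cls_def inj_on_def)
  then show ?thesis using True by simp
next
  case False
  then have "A \<inter> cls V c i = {}" by (auto simp: cls_def)
  then show ?thesis using False by simp
qed

text \<open>A permutation \<open>p\<close> of the classes takes those met by \<open>A\<close> to
  those met by \<open>B\<close>. As all classes have size \<open>k\<close>, each one maps
  bijectively onto its image under \<open>p\<close>, and the bijection can send the point of
  \<open>A\<close> in it, if any, to the point of \<open>B\<close>. These bijections are glued to
  \<open>h\<close>.\<close>

lemma auts_transitive:
  assumes "finite V" and k: "\<And>i. i \<in> c ` V \<Longrightarrow> card (cls V c i) = k"
    and A: "A \<in> transversals r V c" and B: "B \<in> transversals r V c"
  shows "\<exists>h \<in> auts V c. h ` A = B"
proof -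
  have AV: "A \<subseteq> V" "B \<subseteq> V" and cards: "card (c ` A) = r" "card (c ` B) = r"
    and cAB: "card A = r" "card B = r"
    using A B by (auto simp: transversals_def card_image)
  obtain p where p: "bij_betw p (c ` V) (c ` V)" "p ` c ` A = c ` B"
    using bij_betw_image_subset_exists[of "c ` V" "c ` V" "c ` A" "c ` B"] assms AV cards
    by (auto simp: image_mono)
  have pin: "p i \<in> c ` V" if "i \<in> c ` V" for i
    using p(1) that by (auto simp: bij_betw_def)
  have pinj: "p i = p j \<longleftrightarrow> i = j" if "i \<in> c ` V" "j \<in> c ` V" for i j
    using p(1) that by (auto simp: bij_betw_def inj_on_def)
  have pAB: "p i \<in> c ` B \<longleftrightarrow> i \<in> c ` A" if "i \<in> c ` V" for i
    using p that AV unfolding p(2)[symmetric] bij_betw_def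
    by (meson image_mono inj_on_image_mem_iff)
  have "\<exists>f. bij_betw f (cls V c i) (cls V c (p i)) \<and>
      f ` (A \<inter> cls V c i) = B \<inter> cls V c (p i)" if "i \<in> c ` V" for i
  proof (rule bij_betw_image_subset_exists)
    show "card (A \<inter> cls V c i) = card (B \<inter> cls V c (p i))"
      using card_transversal_cls[OF A] card_transversal_cls[OF B] pAB[OF that] by simp
  qed (use assms(1) k pin that in \<open>auto simp: cls_def\<close>)
  then obtain f where f: "\<And>i. i \<in> c ` V \<Longrightarrow> bij_betw (f i) (cls V c i) (cls V c (p i))"
      "\<And>i. i \<in> c ` V \<Longrightarrow> f i ` (A \<inter> cls V c i) = B \<inter> cls V c (p i)"
    by metis
  define h where "h v = (if v \<in> V then f (c v) v else v)" for v
  have hc: "h v \<in> V" "c (h v) = p (c v)" if "v \<in> V" for v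
  proof -
    have "f (c v) v \<in> cls V c (p (c v))"
      using f(1)[of "c v"] that by (auto simp: bij_betw_def cls_def)
    then show "h v \<in> V" "c (h v) = p (c v)" using that by (auto simp: h_def cls_def)
  qed
  have inj: "inj_on h V"
  proof (rule inj_onI)
    fix u v assume uv: "u \<in> V" "v \<in> V" "h u = h v"
    then have "c u = c v" using hc pinj by (metis imageI)
    moreover have "inj_on (f (c v)) (cls V c (c v))"
      using f(1) uv by (auto simp: bij_betw_def)
    ultimately show "u = v"
      using uv by (auto simp: h_def cls_def inj_on_def)
  qed
  then have "h ` V = V" using assms(1) hc by (intro endo_inj_surj) auto
  then have "h permutes V"
    using inj by (intro bij_imp_permutes) (auto simp: bij_betw_def h_def)
  then have aut: "h \<in> auts V c" using hc pinj by (auto simp: auts_def)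
  have "h ` A \<subseteq> B"
  proof
    fix y assume "y \<in> h ` A"
    then obtain a where a: "a \<in> A" "y = h a" by auto
    then have "f (c a) a \<in> f (c a) ` (A \<inter> cls V c (c a))" using AV by (auto simp: cls_def)
    then show "y \<in> B" using f(2)[of "c a"] a AV by (auto simp: h_def)
  qed
  moreover have "card (h ` A) = r"
    using inj AV cAB by (metis card_image inj_on_subset)
  ultimately have "h ` A = B"
    using cAB AV assms(1) by (metis card_subset_eq finite_subset)
  then show ?thesis using aut by blast
qed

text \<open>If \<open>h1\<close> takes \<open>J\<close> to \<open>I\<close> and \<open>h2\<close>
  takes \<open>A\<close> to \<open>B\<close>, then
  \<open>g \<mapsto> h2 \<circ> g \<circ> h1\<close> injects the first set into the second.
  Exchanging the roles gives the other inequality, so no stabiliser has to be counted.\<close>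

lemma card_auts_mapping_eq:
  assumes "finite V" and k: "\<And>i. i \<in> c ` V \<Longrightarrow> card (cls V c i) = k"
    and T: "A \<in> transversals r V c" "B \<in> transversals r V c"
      "I \<in> transversals r V c" "J \<in> transversals r V c"
  shows "card {g \<in> auts V c. g ` I = A} = card {g \<in> auts V c. g ` J = B}"
proof -
  have le: "card {g \<in> auts V c. g ` I = A} \<le> card {g \<in> auts V c. g ` J = B}"
    if T: "A \<in> transversals r V c" "B \<in> transversals r V c"
      "I \<in> transversals r V c" "J \<in> transversals r V c" for A B I J
  proof -
    obtain h1 where h1: "h1 \<in> auts V c" "h1 ` J = I"
      using auts_transitive[OF assms(1) k T(4,3)] by blast
    obtain h2 where h2: "h2 \<in> auts V c" "h2 ` A = B"
      using auts_transitive[OF assms(1) k T(1,2)] by blast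
    have bij: "bij h1" "bij h2"
      using h1 h2 by (auto simp: auts_def permutes_bij)
    have "inj (\<lambda>g. h2 \<circ> g \<circ> h1)"
    proof (rule injI)
      fix g g' assume eq: "h2 \<circ> g \<circ> h1 = h2 \<circ> g' \<circ> h1"
      show "g = g'"
      proof
        fix y
        obtain x where "y = h1 x" using bij(1) by (metis bij_pointE)
        then show "g y = g' y" using fun_cong[OF eq, of x] bij(2) by (simp add: bij_def inj_eq)
      qed
    qed
    then have "inj_on (\<lambda>g. h2 \<circ> g \<circ> h1) {g \<in> auts V c. g ` I = A}"
      by (rule inj_on_subset) simp
    moreover have "(\<lambda>g. h2 \<circ> g \<circ> h1) ` {g \<in> auts V c. g ` I = A} \<subseteq> {g \<in> auts V c. g ` J = B}"
      using h1 h2 by (auto intro!: comp_in_auts simp: image_comp[symmetric])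
    ultimately show ?thesis
      using finite_auts[OF assms(1), of c] by (intro card_inj_on_le) auto
  qed
  show ?thesis by (intro antisym le T)
qed

section \<open>Classes of equal size\<close>

lemma periodic_enumeration:
  assumes "finite V" and k: "\<And>i. i \<in> c ` V \<Longrightarrow> card (cls V c i) = k"
  defines "n \<equiv> card (c ` V)"
  shows "\<exists>e. bij_betw e {..<k * n} V \<and>
    (\<forall>p<k * n. \<forall>q<k * n. c (e p) = c (e q) \<longleftrightarrow> p mod n = q mod n)"
proof -
  obtain a where a: "bij_betw a {..<n} (c ` V)"
    using ex_bij_betw_nat_finite[of "c ` V"] assms by (auto simp: atLeast0LessThan)
  have "\<exists>b. bij_betw b {..<k} (cls V c i)" if "i \<in> c ` V" for i
    using ex_bij_betw_nat_finite[of "cls V c i"] assms(1) k[OF that]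
    by (auto simp: atLeast0LessThan cls_def)
  then obtain b where b: "\<And>i. i \<in> c ` V \<Longrightarrow> bij_betw (b i) {..<k} (cls V c i)"
    by metis
  \<comment> \<open>The cycle consists of \<open>k\<close> rounds of length \<open>n\<close>: each
    round visits the classes in the order \<open>a\<close>, and round \<open>s\<close> takes the
    vertex number \<open>s\<close> of every class.\<close>
  define e where "e p = b (a (p mod n)) (p div n)" for p
  have a': "a (p mod n) \<in> c ` V" "p div n < k" if "p < k * n" for p
  proof -
    have "0 < n" using that by (cases n) auto
    then show "a (p mod n) \<in> c ` V" using a by (auto simp: bij_betw_def)
    show "p div n < k" using that by (simp add: less_mult_imp_div_less)
  qed
  have e: "e p \<in> V" "c (e p) = a (p mod n)" if "p < k * n" for p
  proof -
    have "e p \<in> cls V c (a (p mod n))"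
      using b[OF a'(1)[OF that]] a'(2)[OF that] by (auto simp: e_def bij_betw_def)
    then show "e p \<in> V" "c (e p) = a (p mod n)" by (auto simp: cls_def)
  qed
  have cong: "c (e p) = c (e q) \<longleftrightarrow> p mod n = q mod n" if "p < k * n" "q < k * n" for p q
  proof -
    have "0 < n" using that by (cases n) auto
    then show ?thesis using a e that by (auto simp: bij_betw_def inj_on_def)
  qed
  have "inj_on e {..<k * n}"
  proof (rule inj_onI)
    fix p q assume pq: "p \<in> {..<k * n}" "q \<in> {..<k * n}" "e p = e q"
    then have m: "p mod n = q mod n" using cong[of p q] by auto
    have "inj_on (b (a (p mod n))) {..<k}" using b[OF a'(1)] pq by (auto simp: bij_betw_def)
    then have "p div n = q div n"
      using pq m a'(2)[of p] a'(2)[of q] by (auto simp: e_def inj_on_def)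
    then show "p = q" using m by (metis div_mult_mod_eq)
  qed
  moreover have "e ` {..<k * n} = V"
  proof
    show "e ` {..<k * n} \<subseteq> V" using e by auto
    show "V \<subseteq> e ` {..<k * n}"
    proof
      fix v assume v: "v \<in> V"
      then obtain j where j: "j < n" "a j = c v" using a by (auto simp: bij_betw_def) (metis imageE imageI lessThan_iff)
      have "v \<in> cls V c (c v)" using v by (auto simp: cls_def)
      then obtain s where s: "s < k" "b (c v) s = v"
        using b[of "c v"] v by (auto simp: bij_betw_def) (metis imageE lessThan_iff)
      have "s * n + j < Suc s * n" using j by simp
      also have "\<dots> \<le> k * n" using s by (intro mult_le_mono1) simp
      finally have "s * n + j < k * n" .
      moreover have "e (s * n + j) = v" using j s by (simp add: e_def)
      ultimately show "v \<in> e ` {..<k * n}" by force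
    qed
  qed
  ultimately show ?thesis using cong by (auto simp: bij_betw_def)
qed

lemma sum_card_swap:
  assumes "finite X" "finite Y"
  shows "(\<Sum>x\<in>X. card {y \<in> Y. P x y}) = (\<Sum>y\<in>Y. card {x \<in> X. P x y})"
proof -
  have "(\<Sum>x\<in>X. card {y \<in> Y. P x y}) = (\<Sum>x\<in>X. \<Sum>y\<in>Y. if P x y then 1 else 0)"
    using assms by (simp add: sum.If_cases Int_def)
  also have "\<dots> = (\<Sum>y\<in>Y. \<Sum>x\<in>X. if P x y then 1 else 0)" by (rule sum.swap)
  also have "\<dots> = (\<Sum>y\<in>Y. card {x \<in> X. P x y})"
    using assms by (simp add: sum.If_cases Int_def)
  finally show ?thesis .
qed

lemma equal_classes_card_le_star:
  assumes "finite V" and k: "\<And>i. i \<in> c ` V \<Longrightarrow> card (cls V c i) = k"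
    and "2 \<le> k" "x \<in> V" "r \<le> card (c ` V)"
    and F: "F \<subseteq> transversals r V c" "intersecting F"
  shows "card F \<le> card {A \<in> transversals r V c. x \<in> A}"
proof -
  define n where "n = card (c ` V)"
  define m where "m = k * n"
  obtain e where bij: "bij_betw e {..<m} V"
    and cong: "\<And>p q. p < m \<Longrightarrow> q < m \<Longrightarrow> c (e p) = c (e q) \<longleftrightarrow> p mod n = q mod n"
    using periodic_enumeration[OF assms(1) k] unfolding n_def m_def by blast
  have r: "r \<le> n" using assms by (simp add: n_def)
  have n: "0 < n" using assms(1,4) by (auto simp: n_def card_gt_0_iff)
  \<comment> \<open>Here \<open>2 \<le> k\<close> enters: a cycle of \<open>k * n\<close> vertices
    is long enough for the bound on intersecting intervals.\<close>
  have m: "2 * r \<le> m" "0 < m" "r \<le> m"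
    using mult_le_mono[OF \<open>2 \<le> k\<close> r] n \<open>2 \<le> k\<close> by (auto simp: m_def)
  have I_sub: "cyc_interval m r t \<subseteq> {..<m}" for t
    using m by (auto simp: cyc_interval_def)
  define J where "J t = e ` cyc_interval m r t" for t
  have J: "J t \<in> transversals r V c" for t
  proof -
    have inj: "inj_on e (cyc_interval m r t)"
      using bij I_sub by (auto simp: bij_betw_def intro: inj_on_subset)
    have "n dvd m" by (simp add: m_def)
    note I = inj_on_mod_cyc_interval[OF r this, of t]
    have "card (J t) = r" using inj I by (simp add: J_def card_image)
    moreover have "J t \<subseteq> V" using bij I_sub by (auto simp: J_def bij_betw_def)
    moreover have "inj_on c (J t)"
      unfolding J_def
    proof (rule inj_onI, elim imageE)
      fix y z p q
      assume *: "c y = c z" "y = e p" "p \<in> cyc_interval m r t" "z = e q" "q \<in> cyc_interval m r t"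
      then have "p mod n = q mod n" using cong I_sub[of t] by auto
      then show "y = z" using * I(1) by (auto simp: inj_on_def)
    qed
    ultimately show ?thesis by (simp add: transversals_def)
  qed
  \<comment> \<open>By \<open>card_auts_mapping_eq\<close>, \<open>N\<close> counts the
    automorphisms taking any \<open>J t\<close> to any given transversal, so the choice of
    \<open>J 0\<close> is arbitrary. The identity shows \<open>N\<close> to be positive, which
    permits cancelling it at the end.\<close>
  define N where "N = card {g \<in> auts V c. g ` J 0 = J 0}"
  have "id \<in> {g \<in> auts V c. g ` J 0 = J 0}" using id_in_auts by auto
  then have N: "0 < N"
    using finite_auts[OF assms(1), of c] by (auto simp: N_def card_gt_0_iff)
  have count: "(\<Sum>g\<in>auts V c. card {t \<in> {..<m}. g ` J t \<in> E}) = m * (card E * N)"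
    if E: "E \<subseteq> transversals r V c" for E
  proof -
    have "card {g \<in> auts V c. g ` J t \<in> E} = card E * N" for t
    proof -
      have "{g \<in> auts V c. g ` J t \<in> E} = (\<Union>A\<in>E. {g \<in> auts V c. g ` J t = A})" by auto
      also have "card \<dots> = (\<Sum>A\<in>E. card {g \<in> auts V c. g ` J t = A})"
        using finite_auts[OF assms(1), of c] finite_subset[OF E finite_transversals[OF assms(1)]]
        by (intro card_UN_disjoint) auto
      also have "\<dots> = (\<Sum>A\<in>E. N)"
        unfolding N_def using E J
        by (intro sum.cong refl card_auts_mapping_eq[where k = k] assms(1) k) auto
      finally show ?thesis by simp
    qed
    then show ?thesis
      using sum_card_swap[OF finite_auts[OF assms(1), of c] finite_lessThan[of m]] by simp
  qed
  let ?S = "{A \<in> transversals r V c. x \<in> A}"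
  have "card {t \<in> {..<m}. g ` J t \<in> F} \<le> card {t \<in> {..<m}. g ` J t \<in> ?S}"
    if g: "g \<in> auts V c" for g
  proof -
    have perm: "g permutes V" using g by (simp add: auts_def)
    have "card {t \<in> {..<m}. g ` J t \<in> F} \<le> r"
    proof (rule card_intersecting_cyc_intervals[OF m(1)])
      fix s t
      assume "s \<in> {t \<in> {..<m}. g ` J t \<in> F}" "t \<in> {t \<in> {..<m}. g ` J t \<in> F}"
      then have "g ` J s \<inter> g ` J t \<noteq> {}" using F(2) by (auto simp: intersecting_def)
      then obtain p q where pq: "p \<in> cyc_interval m r s" "q \<in> cyc_interval m r t" "g (e p) = g (e q)"
        by (auto simp: J_def)
      then have "e p = e q" using permutes_inj[OF perm] by (simp add: inj_eq)
      then have "p = q"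
        using bij pq I_sub[of s] I_sub[of t] by (auto simp: bij_betw_def inj_on_def)
      then show "cyc_interval m r s \<inter> cyc_interval m r t \<noteq> {}" using pq by auto
    qed auto
    also have "r \<le> card {t \<in> {..<m}. g ` J t \<in> ?S}"
    proof -
      have "x \<in> g ` V" using permutes_image[OF perm] assms(4) by simp
      then obtain y where y: "y \<in> V" "g y = x" by blast
      then obtain p where p: "p < m" "e p = y" using bij by (auto simp: bij_betw_def)
      have "{t. t < m \<and> p \<in> cyc_interval m r t} \<subseteq> {t \<in> {..<m}. g ` J t \<in> ?S}"
        using auts_image_transversals[OF g J] y p by (auto simp: J_def)
      then have "card {t. t < m \<and> p \<in> cyc_interval m r t} \<le> card {t \<in> {..<m}. g ` J t \<in> ?S}"
        by (intro card_mono) auto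
      then show ?thesis using card_cyc_intervals_through[OF m(3) p(1)] by simp
    qed
    finally show ?thesis .
  qed
  then have "(\<Sum>g\<in>auts V c. card {t \<in> {..<m}. g ` J t \<in> F})
      \<le> (\<Sum>g\<in>auts V c. card {t \<in> {..<m}. g ` J t \<in> ?S})"
    by (rule sum_mono)
  also have "\<dots> = m * (card ?S * N)"
    by (rule count) blast
  finally have "m * (card F * N) \<le> m * (card ?S * N)"
    unfolding count[OF F(1)] .
  then show ?thesis using m N by simp
qed

section \<open>Classes of different sizes\<close>

text \<open>A member of an intersecting family meets itself, so the empty set is excluded. This
  settles \<open>r = 0\<close>, which the induction can reach by lowering \<open>r\<close>.\<close>

lemma intersecting_0:
  assumes "F \<subseteq> transversals 0 V c" "intersecting F" "finite V"
  shows "F = {}"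
proof (rule ccontr)
  assume "F \<noteq> {}"
  then obtain A where A: "A \<in> F" by auto
  then have "finite A" "card A = 0"
    using assms by (auto simp: transversals_def intro: finite_subset)
  then show False using assms(2) A by (auto simp: intersecting_def)
qed

lemma transversals_replace:
  assumes "A \<in> transversals r V c" "v \<in> V" "c v = c w" "v \<noteq> w" "w \<in> A" "finite V"
  shows "insert v (A - {w}) \<in> transversals r (V - {w}) c" "v \<notin> A"
proof -
  have A: "A \<subseteq> V" "card A = r" "inj_on c A" "finite A"
    using assms by (auto simp: transversals_def intro: finite_subset)
  show v: "v \<notin> A" using inj_onD[OF A(3), of v w] assms by auto
  have "card (insert v (A - {w})) = r"
    using A v card_Suc_Diff1[OF A(4) assms(5)] by simp
  moreover have "c v \<notin> c ` (A - {w})"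
    using inj_onD[OF A(3), of _ w] assms(3,5) by auto
  ultimately show "insert v (A - {w}) \<in> transversals r (V - {w}) c"
    using A assms(2,4) by (auto simp: transversals_def intro: inj_on_subset)
qed

lemma transversals_remove:
  assumes "A \<in> transversals r V c" "w \<in> A" "finite V"
  shows "A - {w} \<in> transversals (r - 1) (V - cls V c (c w)) c"
  using assms by (auto simp: transversals_def cls_def inj_on_def card_Diff_singleton)

lemma transversals_insert:
  assumes "A \<in> transversals (r - 1) (V - cls V c (c w)) c" "w \<in> V" "finite V" "0 < r"
  shows "insert w A \<in> transversals r V c" "w \<notin> A"
proof -
  have A: "A \<subseteq> V - cls V c (c w)" "card A = r - 1" "inj_on c A" "finite A"
    using assms(1,3) by (auto simp: transversals_def intro: finite_subset)
  show "w \<notin> A" using A assms by (auto simp: cls_def)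
  moreover have "c w \<notin> c ` A" using A by (auto simp: cls_def)
  ultimately show "insert w A \<in> transversals r V c"
    using A assms by (auto simp: transversals_def)
qed

text \<open>Members of the star without \<open>w\<close>, and members arising by inserting
  \<open>w\<close> into a smaller set, are disjoint parts of the star. This matches the splitting of
  \<open>F\<close> below, so that the two induction bounds add up.\<close>

lemma star_card_split:
  assumes "finite V" "w \<in> V" "x \<in> V" "c x \<noteq> c w" "0 < r"
  shows "card {A \<in> transversals r (V - {w}) c. x \<in> A}
      + card {A \<in> transversals (r - 1) (V - cls V c (c w)) c. x \<in> A}
    \<le> card {A \<in> transversals r V c. x \<in> A}"
proof -
  let ?S1 = "{A \<in> transversals r (V - {w}) c. x \<in> A}"
  let ?S2 = "{A \<in> transversals (r - 1) (V - cls V c (c w)) c. x \<in> A}"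
  have fin: "finite ?S1" "finite ?S2" "finite {A \<in> transversals r V c. x \<in> A}"
    by (simp_all add: assms(1) finite_transversals)
  have "inj_on (insert w) ?S2"
  proof (rule inj_onI)
    fix A B assume *: "A \<in> ?S2" "B \<in> ?S2" "insert w A = insert w B"
    then have "w \<notin> A" "w \<notin> B"
      using transversals_insert(2)[OF _ assms(2,1,5)] by blast+
    then show "A = B" using *(3) by (simp add: insert_ident)
  qed
  then have "card ?S1 + card ?S2 = card ?S1 + card (insert w ` ?S2)" by (simp add: card_image)
  also have "\<dots> = card (?S1 \<union> insert w ` ?S2)"
    using fin by (intro card_Un_disjoint[symmetric]) (auto simp: transversals_def)
  also have "\<dots> \<le> card {A \<in> transversals r V c. x \<in> A}"
    using transversals_insert(1)[OF _ assms(2,1,5)]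
    by (intro card_mono fin) (auto simp: transversals_def)
  finally show ?thesis .
qed

text \<open>\<open>F1\<close> is the image of \<open>F\<close> under moving \<open>w\<close> to
  \<open>v\<close>. The map on sets merges two members exactly when some \<open>A\<close> containing
  \<open>w\<close> has its replacement \<open>f A\<close> in \<open>F\<close> as well;
  \<open>F2\<close> records each such loss as \<open>A - {w}\<close>.\<close>

lemma intersecting_split:
  assumes "finite V" "w \<in> V" "v \<in> V" "c v = c w" "v \<noteq> w"
    and F: "F \<subseteq> transversals r V c" "intersecting F"
  obtains F1 F2 where "F1 \<subseteq> transversals r (V - {w}) c" "intersecting F1"
    "F2 \<subseteq> transversals (r - 1) (V - cls V c (c w)) c" "intersecting F2"
    "card F = card F1 + card F2"
proof -
  define Fn where "Fn = {A \<in> F. w \<notin> A}"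
  define Fw where "Fw = {A \<in> F. w \<in> A}"
  define f where "f A = insert v (A - {w})" for A
  have fin: "finite F" using F(1) finite_transversals[OF assms(1)] by (rule finite_subset)
  have fins: "finite Fn" "finite Fw" using fin by (auto simp: Fn_def Fw_def)
  have notin: "v \<notin> A" if "A \<in> Fw" for A
    using transversals_replace(2)[OF _ assms(3-5) _ assms(1)] that F by (auto simp: Fw_def)
  have inF: "A \<in> F" "w \<in> A" if "A \<in> Fw" for A using that by (auto simp: Fw_def)
  let ?F1 = "Fn \<union> f ` Fw"
  let ?D = "{A \<in> Fw. f A \<in> F}"
  let ?F2 = "(\<lambda>A. A - {w}) ` ?D"
  have "?F1 \<subseteq> transversals r (V - {w}) c"
  proof -
    have "Fn \<subseteq> transversals r (V - {w}) c"
      using F(1) by (auto simp: Fn_def transversals_def)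
    moreover have "f A \<in> transversals r (V - {w}) c" if "A \<in> Fw" for A
      unfolding f_def using that F(1) assms
      by (intro transversals_replace(1)) (auto simp: Fw_def)
    ultimately show ?thesis by auto
  qed
  moreover have "intersecting ?F1"
  proof -
    \<comment> \<open>Seen as the image under a map of points, \<open>?F1\<close> is intersecting at
      once: a common point of two members is mapped to a common point.\<close>
    have im: "id(w := v) ` A = (if w \<in> A then f A else A)" for A
      by (auto simp: f_def image_iff)
    have "F = Fn \<union> Fw" by (auto simp: Fn_def Fw_def)
    then have img: "?F1 = (\<lambda>A. id(w := v) ` A) ` F"
      unfolding im by (auto simp: Fn_def Fw_def image_iff)
    show ?thesis
      unfolding img intersecting_def
    proof (intro ballI, elim imageE)
      fix A B A' B' assume "A = id(w := v) ` A'" "A' \<in> F" "B = id(w := v) ` B'" "B' \<in> F"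
      then show "A \<inter> B \<noteq> {}" using F(2) unfolding intersecting_def by blast
    qed
  qed
  moreover have "?F2 \<subseteq> transversals (r - 1) (V - cls V c (c w)) c"
  proof -
    have "A - {w} \<in> transversals (r - 1) (V - cls V c (c w)) c" if "A \<in> ?D" for A
      using that F(1) by (intro transversals_remove assms(1)) (auto simp: Fw_def)
    then show ?thesis by blast
  qed
  moreover have "intersecting ?F2"
    unfolding intersecting_def
  proof (intro ballI, elim imageE)
    fix A B A' B' assume *: "A = A' - {w}" "A' \<in> ?D" "B = B' - {w}" "B' \<in> ?D"
    \<comment> \<open>\<open>f A'\<close> lies in \<open>F\<close> and so meets \<open>B'\<close>;
      the common point is not \<open>v\<close>, which is missing from \<open>B'\<close>, hence it
      lies in \<open>A' - {w}\<close> and in \<open>B'\<close>.\<close>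
    then have "f A' \<inter> B' \<noteq> {}" "v \<notin> B'"
      using F(2) notin[of B'] inF[of B'] by (auto simp: intersecting_def)
    then show "A \<inter> B \<noteq> {}" using * by (auto simp: f_def)
  qed
  moreover have "card F = card ?F1 + card ?F2"
  proof -
    have injf: "inj_on f Fw"
    proof (rule inj_onI)
      fix A B assume *: "A \<in> Fw" "B \<in> Fw" "f A = f B"
      then have "A - {w} = B - {w}"
        using notin[of A] notin[of B] unfolding f_def by (subst (asm) insert_ident) auto
      then show "A = B" using inF(2)[OF *(1)] inF(2)[OF *(2)] by blast
    qed
    have "inj_on (\<lambda>A. A - {w}) ?D"
      using inF by (intro inj_onI) blast
    then have "card ?F2 = card ?D" by (rule card_image)
    also have "\<dots> = card (f ` ?D)"
      using injf by (intro card_image[symmetric]) (auto elim: inj_on_subset)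
    \<comment> \<open>As \<open>f A\<close> never contains \<open>w\<close>, it lies in
      \<open>F\<close> exactly when it lies in \<open>Fn\<close>.\<close>
    also have "f ` ?D = Fn \<inter> f ` Fw"
      using assms(5) by (auto simp: Fn_def f_def)
    finally have "card ?F1 + card ?F2 = card Fn + card (f ` Fw)"
      using card_Un_Int[OF fins(1) finite_imageI[OF fins(2), of f]] by simp
    also have "\<dots> = card Fn + card Fw" using injf by (simp add: card_image)
    also have "\<dots> = card (Fn \<union> Fw)"
      using fins by (intro card_Un_disjoint[symmetric]) (auto simp: Fn_def Fw_def)
    also have "Fn \<union> Fw = F" by (auto simp: Fn_def Fw_def)
    finally show ?thesis by simp
  qed
  ultimately show thesis by (rule that)
qed

text \<open>The vertex \<open>x\<close> stays fixed through the induction on \<open>card V\<close>,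
  so both parts are bounded by stars at the same vertex. Its class remains a smallest one, since
  vertices are only deleted from a strictly larger class.\<close>

lemma card_le_star:
  assumes "finite V" "x \<in> V" "2 \<le> card (cls V c (c x))"
    and "\<And>v. v \<in> V \<Longrightarrow> card (cls V c (c x)) \<le> card (cls V c (c v))"
    and "r \<le> card (c ` V)" "F \<subseteq> transversals r V c" "intersecting F"
  shows "card F \<le> card {A \<in> transversals r V c. x \<in> A}"
  using assms
proof (induction "card V" arbitrary: V r F rule: less_induct)
  case less
  note fin = less.prems(1) and min = less.prems(4)
  show ?case
  proof (cases "r = 0 \<or> (\<forall>v\<in>V. card (cls V c (c v)) = card (cls V c (c x)))")
    case True
    then show ?thesis
    proof
      assume "r = 0"
      then show ?thesis using intersecting_0 less.prems by (metis card.empty zero_le)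
    next
      assume "\<forall>v\<in>V. card (cls V c (c v)) = card (cls V c (c x))"
      then have "card (cls V c i) = card (cls V c (c x))" if "i \<in> c ` V" for i
        using that by blast
      then show ?thesis
        by (rule equal_classes_card_le_star[OF fin _ less.prems(3,2,5,6,7)])
    qed
  next
    case False
    then obtain w where w: "w \<in> V" "card (cls V c (c w)) > card (cls V c (c x))" and r: "0 < r"
      using min by (metis le_neq_implies_less bot_nat_0.not_eq_extremum)
    have xw: "c x \<noteq> c w" using w by auto
    have "\<not> cls V c (c w) \<subseteq> {w}"
      using card_mono[of "{w}" "cls V c (c w)"] w less.prems(3) by auto
    then obtain v where v: "v \<in> V" "c v = c w" "v \<noteq> w" by (auto simp: cls_def)
    obtain F1 F2 where F: "F1 \<subseteq> transversals r (V - {w}) c" "intersecting F1"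
      "F2 \<subseteq> transversals (r - 1) (V - cls V c (c w)) c" "intersecting F2"
      "card F = card F1 + card F2"
      using intersecting_split[OF fin w(1) v less.prems(6,7)] by blast
    have cls1: "cls (V - {w}) c i = cls V c i - {w}" for i by (auto simp: cls_def)
    have cls2: "cls (V - cls V c (c w)) c i = cls V c i" if "i \<noteq> c w" for i
      using that by (auto simp: cls_def)
    have wx: "w \<notin> cls V c (c x)" using xw by (auto simp: cls_def)
    have "card F1 \<le> card {A \<in> transversals r (V - {w}) c. x \<in> A}"
    proof (rule less.hyps)
      show "card (V - {w}) < card V" using fin w(1) by (rule card_Diff1_less)
      \<comment> \<open>The vertex \<open>v\<close> still represents the class of \<open>w\<close>,
        so no class disappears and \<open>r\<close> may stay.\<close>
      have "c ` (V - {w}) = c ` V" using v by (auto simp: image_iff) (metis DiffI singletonD)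
      then show "r \<le> card (c ` (V - {w}))" using less.prems by simp
      show "card (cls (V - {w}) c (c x)) \<le> card (cls (V - {w}) c (c u))" if "u \<in> V - {w}" for u
      proof (cases "c u = c w")
        case True
        then have "w \<in> cls V c (c u)" using w(1) by (simp add: cls_def)
        \<comment> \<open>The class of \<open>w\<close> was strictly larger than that of
          \<open>x\<close>, so losing one vertex does not violate minimality.\<close>
        then show ?thesis using w(2) wx True by (simp add: cls1 card_Diff_singleton)
      next
        case False
        then have "w \<notin> cls V c (c u)" by (auto simp: cls_def)
        then show ?thesis using wx min that by (simp add: cls1)
      qed
    qed (use less.prems xw wx F in \<open>auto simp: cls1\<close>)
    moreover have "card F2 \<le> card {A \<in> transversals (r - 1) (V - cls V c (c w)) c. x \<in> A}"
    proof (rule less.hyps)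
      show "card (V - cls V c (c w)) < card V"
        using fin w(1) by (intro psubset_card_mono) (auto simp: cls_def)
      \<comment> \<open>One class is lost, and the size of the sets drops by one along with
        it.\<close>
      have "c ` (V - cls V c (c w)) = c ` V - {c w}" by (auto simp: cls_def)
      then show "r - 1 \<le> card (c ` (V - cls V c (c w)))"
        using less.prems w by (simp add: card_Diff_singleton)
      show "card (cls (V - cls V c (c w)) c (c x)) \<le> card (cls (V - cls V c (c w)) c (c u))"
        if "u \<in> V - cls V c (c w)" for u
      proof -
        have "c u \<noteq> c w" "u \<in> V" using that by (auto simp: cls_def)
        then show ?thesis using min xw by (simp add: cls2)
      qed
    qed (use less.prems xw F in \<open>auto simp: cls2\<close>, auto simp: cls_def)
    ultimately show ?thesis
      using star_card_split[OF fin w(1) less.prems(2) xw r] F(5) by linarith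
  qed
qed

section \<open>Disjoint unions of complete graphs\<close>

theorem theorem4:
  fixes r n :: nat
    and G :: "'a pair_pre_digraph"
    and H :: "nat \<Rightarrow> 'a pair_pre_digraph"
    and m :: "nat \<Rightarrow> nat"
  assumes "1 \<le> r" and "r \<le> n"
    and "is_disjoint_union G {..<n} H"
    and "\<And>i. i < n \<Longrightarrow> complete_digraph (m i) (with_proj (H i))"
    and "\<And>i. i < n \<Longrightarrow> 2 \<le> m i"
  shows "EKR r G"
proof -
  let ?V = "pverts G"
  have disj: "disjoint_family_on (\<lambda>i. pverts (H i)) {..<n}"
    and V: "?V = (\<Union>i<n. pverts (H i))" and E: "parcs G = (\<Union>i<n. parcs (H i))"
    using assms(3) by (auto simp: is_disjoint_union_def)
  have H: "finite (pverts (H i))" "card (pverts (H i)) = m i"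
    "parcs (H i) = {(u, v). u \<in> pverts (H i) \<and> v \<in> pverts (H i) \<and> u \<noteq> v}" if "i < n" for i
    using assms(4)[OF that] by (auto simp: complete_digraph_pair_def)
  \<comment> \<open>Disjointness makes the index unique on \<open>?V\<close>; elsewhere the value is
    unspecified.\<close>
  define c where "c v = (THE i. i < n \<and> v \<in> pverts (H i))" for v
  have c: "c v = i" if "i < n" "v \<in> pverts (H i)" for v i
    unfolding c_def using that disj by (intro the_equality) (auto simp: disjoint_family_on_def)
  have cV: "c v < n" "v \<in> pverts (H (c v))" if "v \<in> ?V" for v
    using that c by (auto simp: V)
  have cls: "cls ?V c i = pverts (H i)" if "i < n" for i
    using that c cV by (auto simp: cls_def V)
  have im: "c ` ?V = {..<n}"
  proof
    show "c ` ?V \<subseteq> {..<n}" using cV by auto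
    show "{..<n} \<subseteq> c ` ?V"
    proof
      fix i assume "i \<in> {..<n}"
      then have i: "i < n" by simp
      then have "pverts (H i) \<noteq> {}" using H(2)[of i] assms(5)[of i] by auto
      then show "i \<in> c ` ?V" using i c by (force simp: V)
    qed
  qed
  have fin: "finite ?V" using H(1) by (auto simp: V)
  have adj: "(u, v) \<in> parcs G \<longleftrightarrow> u \<noteq> v \<and> c u = c v" if "u \<in> ?V" "v \<in> ?V" for u v
  proof
    assume "(u, v) \<in> parcs G"
    then obtain i where "i < n" "(u, v) \<in> parcs (H i)" by (auto simp: E)
    then show "u \<noteq> v \<and> c u = c v" using H(3)[of i] c[of i] by auto
  next
    assume *: "u \<noteq> v \<and> c u = c v"
    then have "(u, v) \<in> parcs (H (c u))"
      using H(3)[OF cV(1)[OF that(1)]] cV(2)[OF that(1)] cV(2)[OF that(2)] by auto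
    then show "(u, v) \<in> parcs G" using cV(1)[OF that(1)] by (auto simp: E)
  qed
  have indep: "indep_family r G = transversals r ?V c"
  proof -
    have "independent_set G A \<longleftrightarrow> inj_on c A" if "A \<subseteq> ?V" for A
      using that adj unfolding independent_set_def inj_on_def by blast
    then show ?thesis by (auto simp: indep_family_def transversals_def)
  qed
  \<comment> \<open>From \<open>1 \<le> r \<le> n\<close> there is a vertex, so a smallest class
    exists; its star will be bounded by \<open>Max\<close>.\<close>
  have "c ` ?V \<noteq> {}" using assms(1,2) unfolding im by (simp add: lessThan_empty_iff)
  then have "?V \<noteq> {}" by blast
  then obtain x where x: "x \<in> ?V"
    and min: "\<And>v. v \<in> ?V \<Longrightarrow> card (cls ?V c (c x)) \<le> card (cls ?V c (c v))"
    using arg_min_if_finite(1)[OF fin, of "\<lambda>v. card (cls ?V c (c v))"]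
      arg_min_least[OF fin, of _ "\<lambda>v. card (cls ?V c (c v))"] by blast
  show ?thesis
    unfolding EKR_def
  proof (intro allI impI)
    fix \<A> assume A: "\<A> \<subseteq> indep_family r G" "intersecting \<A>"
    have "card \<A> \<le> card {A \<in> transversals r ?V c. x \<in> A}"
    proof (rule card_le_star[OF fin x _ min])
      show "2 \<le> card (cls ?V c (c x))" using assms(5) cV(1)[OF x] by (simp add: cls H(2))
    qed (use A assms(2) in \<open>simp_all add: im indep\<close>)
    also have "\<dots> = card (indep_star r G x)" by (simp add: indep_star_def indep)
    also have "\<dots> \<le> Max ((\<lambda>v. card (indep_star r G v)) ` ?V)"
      using fin x by (intro Max_ge) auto
    finally show "card \<A> \<le> Max ((\<lambda>v. card (indep_star r G v)) ` ?V)" .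
  qed
qed

end
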